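(* There exists an absolute constant $c$ such that the following holds. Let $\mathbf{X}_1,\ldots,\mathbf{X}_n$ be random vectors in $\mathbb{R}^d$ on a common probability space, with $\mathcal{F}_i=\sigma(\mathbf{X}_1,\ldots,\mathbf{X}_i)$ the $\sigma$-algebra generated by $\mathbf{X}_1,\ldots,\mathbf{X}_i$ for $i\in\{1,\ldots,n\}$, and $\mathcal{F}_0$ the trivial $\sigma$-algebra. Let $\sigma_1,\ldots,\sigma_n$ be positive real random variables such that $\sigma_i$ is $\mathcal{F}_{i-1}$-measurable for each $i$, and suppose that for every $i\in\{1,\ldots,n\}$, $$\mathbb{E}[\mathbf{X}_i\mid\mathcal{F}_{i-1}]=0,\qquad \mathbb{P}\left(\|\mathbf{X}_i\|\ge t\mid\mathcal{F}_{i-1}\right)\le 2e^{-\frac{t^2}{2\sigma_i^2}}\quad\text{for all } t\ge 0.$$ Then for any fixed $\delta>0$ and $B>b>0$, with probability at least $1-\delta$, $$\text{either}\quad \sum_{i=1}^n\sigma_i^2\ge B\quad\text{or}\quad \left\|\sum_{i=1}^n\mathbf{X}_i\right\|\le c\cdot\sqrt{\max\left\{\sum_{i=1}^n\sigma_i^2,\;b\right\}\cdot\left(\log\frac{2d}{\delta}+\log\log\frac{B}{b}\right)}.$$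
   Context: $\|\cdot\|$ is the Euclidean norm on $\mathbb{R}^d$ and $\log$ is the natural logarithm. "Absolute constant" means that $c$ does not depend on $d$, $n$, $\delta$, $B$, $b$, the $\sigma_i$, or the distribution of the vectors. The numbers $\delta,B,b$ are deterministic; the $\sigma_i$ may be random. The conclusion says that the union of the two events has probability at least $1-\delta$.
   Formalization: log log(B/b) is replaced by max{0, log log(B/b)}, since the bound fails for B/b near 1 (d=n=1, fair sign, σ=1, δ=1/2, b=2, B=2e^{1/4}); c is stated per sample-space type, but passing to the law of the X_i gives one c for all. *)

theory Defs
  imports "HOL-Probability.Probability"
begin

text \<open>
  The constant of the theorem must not depend on the dimension, so the dimension has to be a
  natural number bound inside the statement and not a type. A vector of R^d is therefore an element
  of \<open>{..<d} \<rightarrow>\<^sub>E UNIV\<close>, the space of the product measurable space below; its Borel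
  sigma-algebra is the product one, and its Euclidean norm is \<^term>\<open>L2_set x {..<d}\<close>.
\<close>

abbreviation borel_vec :: "nat \<Rightarrow> (nat \<Rightarrow> real) measure" where
  "borel_vec d \<equiv> Pi\<^sub>M {..<d} (\<lambda>_. borel)"

text \<open>For \<open>i = 0\<close> the generating family is empty and this is the trivial sigma-algebra.\<close>

definition generated_algebra ::
    "'a measure \<Rightarrow> nat \<Rightarrow> (nat \<Rightarrow> 'a \<Rightarrow> nat \<Rightarrow> real) \<Rightarrow> nat \<Rightarrow> 'a measure" where
  "generated_algebra M d X i =
     sigma (space M) (\<Union>j\<in>{1..i}. {X j -` A \<inter> space M | A. A \<in> sets (borel_vec d)})"

definition cond_prob_given :: "'a measure \<Rightarrow> 'a measure \<Rightarrow> 'a set \<Rightarrow> 'a \<Rightarrow> real" where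
  "cond_prob_given M F A = real_cond_exp M F (indicator A)"

text \<open>
  The conditional mean is taken coordinatewise. No integrability of \<open>X i\<close> is required:
  \<^const>\<open>real_cond_exp\<close> is the difference of the conditional expectations of the positive and the
  negative part, and the tail bound makes both of them finite almost surely.
\<close>

definition norm_subGaussian_mds ::
    "'a measure \<Rightarrow> nat \<Rightarrow> nat \<Rightarrow> (nat \<Rightarrow> 'a \<Rightarrow> nat \<Rightarrow> real) \<Rightarrow> (nat \<Rightarrow> 'a \<Rightarrow> real) \<Rightarrow> bool" where
  "norm_subGaussian_mds M d n X \<sigma> \<longleftrightarrow>
     (\<forall>i\<in>{1..n}.
        X i \<in> measurable M (borel_vec d) \<and>
        \<sigma> i \<in> borel_measurable (generated_algebra M d X (i - 1)) \<and>
        (\<forall>\<omega>\<in>space M. 0 < \<sigma> i \<omega>) \<and>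
        (\<forall>k<d. AE \<omega> in M.
           real_cond_exp M (generated_algebra M d X (i - 1)) (\<lambda>\<omega>. X i \<omega> k) \<omega> = 0) \<and>
        (\<forall>t\<ge>0. AE \<omega> in M.
           cond_prob_given M (generated_algebra M d X (i - 1))
             {\<omega> \<in> space M. L2_set (X i \<omega>) {..<d} \<ge> t} \<omega>
             \<le> 2 * exp (- (t\<^sup>2 / (2 * (\<sigma> i \<omega>)\<^sup>2)))))"

text \<open>
  The theorem uses \<open>max 0 (ln (ln (B / b)))\<close> for log log (B / b). The two agree when B / b is at
  least e. Below that the plain expression is negative and unbounded, and the bound would fail:
  with d = n = 1, a fair sign, \<open>\<sigma>\<close> = 1, \<open>\<delta>\<close> = 1/2, b = 2 and B = 2 exp (1/4) it would be 0.
\<close>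

end

theory Submission
  imports Defs
begin

text \<open>
  Write \<open>S\<close> for the partial sums of the vectors, \<open>V\<close> for those of the \<open>(\<sigma> i)\<^sup>2\<close>, and \<open>|S|\<close> for the
  Euclidean norm. The proof follows Pinelis' method for martingales in a Hilbert space: for every
  \<open>l \<ge> 0\<close> the process \<open>cosh (l |S|) exp (- 5 l\<^sup>2 V)\<close> is a supermartingale that starts at \<open>1\<close>.

  The supermartingale property rests on two facts. The first is geometric: as \<open>cosh (sqrt u)\<close> is
  convex in \<open>u\<close>, the number \<open>cosh (l |s + x|)\<close> is at most
  \<open>cosh (l |s|) (exp (l |x|) - l |x|)\<close> plus a term that is linear in \<open>x\<close>
  (\<open>cosh_L2_set_add_le\<close>). The linear term has conditional mean zero when \<open>x\<close> is a martingale
  increment. The second is the moment bound \<open>E[exp (l |X|) - l |X|] \<le> exp (5 l\<^sup>2 \<sigma>\<^sup>2)\<close>, conditionally on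
  the past, which follows from the sub-Gaussian tail by integrating over the level sets
  (\<open>nn_integral_exp_le_of_subGaussian_tail\<close>). The subtracted linear term makes the exponent
  quadratic in \<open>l\<close>. Both are combined in \<open>cosh_norm_supermartingale_step\<close>, and induction gives
  \<open>cosh_supermartingale_expectation_le_1\<close>.

  By Markov's inequality, \<open>l |S| \<le> q + 5 l\<^sup>2 V\<close> with \<open>q = ln (2 K / \<delta>)\<close>, outside an event of
  probability at most \<open>\<delta> / K\<close>. The best \<open>l\<close> is of order \<open>sqrt (q / V)\<close>, but \<open>V\<close> is random and \<open>l\<close>
  is not. Therefore one value of \<open>l\<close> is used for each of the \<open>K\<close> dyadic scales between \<open>b\<close> and \<open>B\<close>;
  one of them is right up to a factor \<open>2\<close> whenever \<open>V < B\<close>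
  (\<open>norm_le_of_cosh_le_at_all_scales\<close>). As \<open>K\<close> is at most of order \<open>max 1 (ln (B / b))\<close>, the union bound
  costs the term \<open>max 0 (ln (ln (B / b)))\<close>.
\<close>

section \<open>The hyperbolic cosine of a Euclidean norm\<close>

text \<open>
  The power series of \<open>cosh\<close> contains only even powers, so that
  \<open>cosh (sqrt u)\<close> is a power series in \<open>u\<close> with nonnegative coefficients, and each of its terms is
  convex on the half-line.
\<close>

lemma convex_on_cosh_sqrt: "convex_on {0::real..} (\<lambda>u. cosh (sqrt u))"
proof (rule convex_onI)
  define g where "g n u = (if even n then u ^ (n div 2) / fact n else 0)" for n :: nat and u :: real
  have g_sums: "(\<lambda>n. g n u) sums cosh (sqrt u)" if "0 \<le> u" for u
  proof -
    have "g n u = (if even n then sqrt u ^ n /\<^sub>R fact n else 0)" for n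
      using that by (auto simp: g_def divide_inverse power_mult elim!: evenE)
    then show ?thesis using cosh_converges[of "sqrt u"] by simp
  qed
  have convex_power: "convex_on {0::real..} (\<lambda>u. u ^ k)" for k
    using convex_power_even[of k] convex_power_odd[of k] by (cases "even k") (auto intro: convex_on_subset)
  fix t x y :: real assume t: "0 < t" "t < 1" and xy: "x \<in> {0..}" "y \<in> {0..}"
  have *: "g n ((1 - t) *\<^sub>R x + t *\<^sub>R y) \<le> (1 - t) * g n x + t * g n y" for n
    using convex_onD[OF convex_power[of "n div 2"], of t x y] t xy
    by (simp add: g_def divide_right_mono add_divide_distrib[symmetric])
  show "cosh (sqrt ((1 - t) *\<^sub>R x + t *\<^sub>R y)) \<le> (1 - t) * cosh (sqrt x) + t * cosh (sqrt y)"
    using t xy by (intro sums_le[OF * g_sums] sums_add sums_mult g_sums) auto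
qed auto

text \<open>
  Think of \<open>a\<close> and \<open>r\<close> as the lengths of two vectors with inner product \<open>p = v a r\<close>. By the law of
  cosines the squared length of their sum is affine in \<open>v \<in> [-1, 1]\<close>, so by
  \<open>convex_on_cosh_sqrt\<close> the left-hand side lies below the chord through the two collinear cases
  \<open>v = 1\<close> and \<open>v = -1\<close>, which is \<open>cosh (l a) cosh (l r) + v sinh (l a) sinh (l r)\<close>. The part of
  the last term that is linear in \<open>r\<close> is kept as it is, because a martingale increment averages it
  out; the rest is absorbed with \<open>v sinh (l a) \<le> cosh (l a)\<close>.
  For \<open>a = 0\<close> also \<open>p = 0\<close>, and the linear term vanishes.
\<close>

lemma cosh_sqrt_cosine_rule_le:
  fixes a r p l :: real
  assumes "0 \<le> a" "0 \<le> r" "0 \<le> l" "\<bar>p\<bar> \<le> a * r"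
  shows "cosh (l * sqrt (a\<^sup>2 + 2 * p + r\<^sup>2))
           \<le> cosh (l * a) * (exp (l * r) - l * r) + l * (sinh (l * a) / a) * p"
proof -
  have sinh_ge: "l * r \<le> sinh (l * r)"
    using real_le_x_sinh[of "l * r"] assms by (simp add: sinh_field_def exp_minus)
  show ?thesis
  proof (cases "a * r = 0")
    case True
    then have "p = 0" "a = 0 \<or> r = 0" using assms by auto
    then show ?thesis
      using sinh_ge cosh_plus_sinh[of "l * r"] assms by (auto simp: real_sqrt_abs)
  next
    case False
    then have pos: "0 < a" "0 < r" using assms by auto
    define v where "v = p / (a * r)"
    have v: "\<bar>v\<bar> \<le> 1" "p = v * (a * r)" using assms pos by (auto simp: v_def)
    have sqrt_eq: "sqrt (l\<^sup>2 * (a - r)\<^sup>2) = \<bar>l * a - l * r\<bar>" "sqrt (l\<^sup>2 * (a + r)\<^sup>2) = l * a + l * r"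
      using assms pos
      by (simp_all add: real_sqrt_mult abs_mult right_diff_distrib[symmetric] distrib_left)
    have "cosh (l * sqrt (a\<^sup>2 + 2 * p + r\<^sup>2)) = cosh (sqrt (l\<^sup>2 * (a\<^sup>2 + 2 * p + r\<^sup>2)))"
      using assms by (simp add: real_sqrt_mult)
    also have "l\<^sup>2 * (a\<^sup>2 + 2 * p + r\<^sup>2)
        = (1 - (1 + v) / 2) *\<^sub>R (l\<^sup>2 * (a - r)\<^sup>2) + ((1 + v) / 2) *\<^sub>R (l\<^sup>2 * (a + r)\<^sup>2)"
      unfolding v(2) by (simp add: power2_eq_square field_simps)
    also have "cosh (sqrt \<dots>) \<le> (1 - (1 + v) / 2) * cosh (sqrt (l\<^sup>2 * (a - r)\<^sup>2))
        + ((1 + v) / 2) * cosh (sqrt (l\<^sup>2 * (a + r)\<^sup>2))"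
      using v by (intro convex_onD[OF convex_on_cosh_sqrt]) (auto simp: abs_le_iff)
    also have "\<dots> = cosh (l * a) * cosh (l * r) + v * (sinh (l * a) * sinh (l * r))"
      unfolding sqrt_eq cosh_real_abs by (simp add: cosh_add cosh_diff field_simps)
    also have "\<dots> = cosh (l * a) * cosh (l * r) + v * sinh (l * a) * (sinh (l * r) - l * r)
        + l * (sinh (l * a) / a) * p"
      using pos unfolding v(2) by (simp add: field_simps)
    also have "v * sinh (l * a) * (sinh (l * r) - l * r) \<le> cosh (l * a) * (sinh (l * r) - l * r)"
    proof (rule mult_right_mono)
      have "v * sinh (l * a) \<le> 1 * sinh (l * a)"
        using v assms by (intro mult_right_mono) auto
      also have "\<dots> \<le> cosh (l * a)" using sinh_less_cosh_real[of "l * a"] by simp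
      finally show "v * sinh (l * a) \<le> cosh (l * a)" .
    qed (use sinh_ge in auto)
    finally show ?thesis
      by (simp add: cosh_plus_sinh[symmetric] algebra_simps)
  qed
qed

lemma L2_set_add_power2:
  "(L2_set (\<lambda>k. s k + x k) A)\<^sup>2 = (L2_set s A)\<^sup>2 + 2 * (\<Sum>k\<in>A. s k * x k) + (L2_set x A)\<^sup>2"
proof -
  have sq: "(L2_set f A)\<^sup>2 = (\<Sum>k\<in>A. (f k)\<^sup>2)" for f :: "'a \<Rightarrow> real"
    by (simp add: L2_set_def sum_nonneg)
  show ?thesis
    unfolding sq by (simp add: power2_sum sum.distrib sum_distrib_left mult.assoc)
qed

text \<open>
  This form exhibits the coefficient of each coordinate of \<open>x\<close> as a function of \<open>s\<close> alone, as needed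
  for taking conditional expectations given the past.
\<close>

lemma cosh_L2_set_add_le:
  assumes "finite A" "0 \<le> l"
  shows "cosh (l * L2_set (\<lambda>k. s k + x k) A)
     \<le> cosh (l * L2_set s A) * (exp (l * L2_set x A) - l * L2_set x A)
        + (\<Sum>k\<in>A. l * (sinh (l * L2_set s A) / L2_set s A) * s k * x k)"
proof -
  have "\<bar>\<Sum>k\<in>A. s k * x k\<bar> \<le> (\<Sum>k\<in>A. \<bar>s k\<bar> * \<bar>x k\<bar>)"
    by (rule order_trans[OF sum_abs]) (simp add: abs_mult)
  also have "\<dots> \<le> L2_set s A * L2_set x A" by (rule L2_set_mult_ineq)
  finally have "\<bar>\<Sum>k\<in>A. s k * x k\<bar> \<le> L2_set s A * L2_set x A" .
  moreover have "L2_set (\<lambda>k. s k + x k) A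
      = sqrt ((L2_set s A)\<^sup>2 + 2 * (\<Sum>k\<in>A. s k * x k) + (L2_set x A)\<^sup>2)"
    by (simp add: L2_set_add_power2[symmetric])
  ultimately show ?thesis
    using cosh_sqrt_cosine_rule_le[of "L2_set s A" "L2_set x A" l "\<Sum>k\<in>A. s k * x k"] assms
    by (simp add: sum_distrib_left mult.assoc)
qed

section \<open>Exponential moments from a sub-Gaussian tail\<close>

text \<open>
  This writes \<open>exp (l r) - l r - 1\<close> as an integral of the indicators of \<open>t \<le> r\<close>, and so reduces its
  expectation for a random \<open>r\<close> to the tail probabilities of \<open>r\<close>.
\<close>

lemma nn_integral_exp_layer_cake:
  fixes r l :: real
  assumes "0 \<le> r" "0 \<le> l"
  shows "(\<integral>\<^sup>+t. ennreal (l * (exp (l * t) - 1)) * indicator {0..r} t \<partial>lborel)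
           = ennreal (exp (l * r) - l * r - 1)"
proof -
  have "(\<integral>\<^sup>+t. ennreal (l * (exp (l * t) - 1)) * indicator {0..r} t \<partial>lborel)
      = ennreal ((exp (l * r) - l * r) - (exp (l * 0) - l * 0))"
    using assms
    by (intro nn_integral_FTC_Icc)
       (auto intro!: derivative_eq_intros mult_nonneg_nonneg simp: mult.commute[of l] left_diff_distrib mult_le_cancel_right1)
  then show ?thesis by simp
qed

text \<open>
  Turns the output of the next lemma into a single exponential, the shape that multiplies up along a
  martingale.
\<close>

lemma one_plus_mult_exp_le_exp:
  fixes x :: real
  assumes "0 \<le> x"
  shows "1 + 4 * x * exp x \<le> exp (5 * x)"
proof -
  have "1 + 4 * x * exp x \<le> exp x + 4 * x * exp x" using assms by simp
  also have "\<dots> = exp x * (1 + 4 * x)" by (simp add: algebra_simps)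
  also have "\<dots> \<le> exp x * exp (4 * x)" by (intro mult_left_mono exp_ge_add_one_self) auto
  also have "\<dots> = exp (5 * x)" by (simp add: mult_exp_exp)
  finally show ?thesis .
qed

text \<open>
  Here \<open>l (exp (l t) - 1) \<le> l\<^sup>2 t exp (l t)\<close>, and \<open>l t \<le> l\<^sup>2 s\<^sup>2 + t\<^sup>2 / (4 s\<^sup>2)\<close> gives away half of the
  Gaussian exponent. What remains is a multiple of \<open>t exp (- t\<^sup>2 / (4 s\<^sup>2))\<close>, which has an elementary
  primitive. The \<open>- 1\<close>, which comes from the subtracted linear term \<open>l r\<close> in
  \<open>nn_integral_exp_layer_cake\<close>, is what makes the bound of order \<open>l\<^sup>2\<close> for small \<open>l\<close>.
\<close>

lemma nn_integral_gaussian_layer_le: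
  fixes s l :: real
  assumes "0 < s" "0 \<le> l"
  shows "(\<integral>\<^sup>+t. ennreal (l * (exp (l * t) - 1)) * indicator {0..} t
                * ennreal (2 * exp (- (t\<^sup>2 / (2 * s\<^sup>2)))) \<partial>lborel)
           \<le> ennreal (4 * (l\<^sup>2 * s\<^sup>2) * exp (l\<^sup>2 * s\<^sup>2))"
proof -
  define C where "C = 2 * l\<^sup>2 * exp (l\<^sup>2 * s\<^sup>2)"
  have C: "0 \<le> C" by (simp add: C_def)
  have *: "l * (exp (l * t) - 1) * (2 * exp (- (t\<^sup>2 / (2 * s\<^sup>2))))
      \<le> C * (t * exp (- (t\<^sup>2 / (4 * s\<^sup>2))))" if t: "0 \<le> t" for t
  proof -
    have "1 - l * t \<le> exp (- (l * t))" using exp_ge_add_one_self[of "- (l * t)"] by simp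
    then have "(1 - l * t) * exp (l * t) \<le> exp (- (l * t)) * exp (l * t)"
      by (intro mult_right_mono) auto
    then have 1: "exp (l * t) - 1 \<le> l * t * exp (l * t)"
      by (simp add: mult_exp_exp algebra_simps)
    have "0 \<le> (l * s - t / (2 * s))\<^sup>2" by simp
    then have "l * t \<le> l\<^sup>2 * s\<^sup>2 + t\<^sup>2 / (4 * s\<^sup>2)"
      using assms by (simp add: power2_diff power_mult_distrib power_divide)
    then have "l * t - t\<^sup>2 / (2 * s\<^sup>2) \<le> l\<^sup>2 * s\<^sup>2 - t\<^sup>2 / (4 * s\<^sup>2)"
      using field_sum_of_halves[of "t\<^sup>2 / (2 * s\<^sup>2)"] by simp
    then have 2: "exp (l * t) * exp (- (t\<^sup>2 / (2 * s\<^sup>2))) \<le> exp (l\<^sup>2 * s\<^sup>2) * exp (- (t\<^sup>2 / (4 * s\<^sup>2)))"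
      by (simp add: mult_exp_exp)
    have "l * (exp (l * t) - 1) * (2 * exp (- (t\<^sup>2 / (2 * s\<^sup>2))))
        \<le> l * (l * t * exp (l * t)) * (2 * exp (- (t\<^sup>2 / (2 * s\<^sup>2))))"
      using 1 assms by (intro mult_right_mono mult_left_mono) auto
    also have "\<dots> = 2 * l\<^sup>2 * t * (exp (l * t) * exp (- (t\<^sup>2 / (2 * s\<^sup>2))))"
      by (simp add: power2_eq_square)
    also have "\<dots> \<le> 2 * l\<^sup>2 * t * (exp (l\<^sup>2 * s\<^sup>2) * exp (- (t\<^sup>2 / (4 * s\<^sup>2))))"
      using 2 t by (intro mult_left_mono) auto
    finally show ?thesis by (simp add: C_def mult_ac)
  qed
  have "(\<integral>\<^sup>+t. ennreal (l * (exp (l * t) - 1)) * indicator {0..} t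
                * ennreal (2 * exp (- (t\<^sup>2 / (2 * s\<^sup>2)))) \<partial>lborel)
      \<le> (\<integral>\<^sup>+t. ennreal (C * (t * exp (- (t\<^sup>2 / (4 * s\<^sup>2))))) * indicator {0..} t \<partial>lborel)"
    using * assms
    by (intro nn_integral_mono) (auto simp: ennreal_mult''[symmetric] split: split_indicator intro!: ennreal_leI)
  also have "\<dots> = ennreal (0 - (- (2 * s\<^sup>2 * C) * exp (- (0\<^sup>2 / (4 * s\<^sup>2)))))"
  proof (rule nn_integral_FTC_atLeast)
    show "((\<lambda>t. - (2 * s\<^sup>2 * C) * exp (- (t\<^sup>2 / (4 * s\<^sup>2)))) \<longlongrightarrow> 0) at_top"
    proof (rule tendsto_mult_right_zero, rule filterlim_compose[OF exp_at_bot])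
      have "filterlim (\<lambda>t. t\<^sup>2 * inverse (4 * s\<^sup>2)) at_top at_top"
        using assms by (intro filterlim_at_top_mult_tendsto_pos[OF tendsto_const] filterlim_pow_at_top filterlim_ident) auto
      from this[THEN filterlim_uminus_at_top[THEN iffD1]]
      show "filterlim (\<lambda>t. - (t\<^sup>2 / (4 * s\<^sup>2))) at_bot at_top"
        unfolding divide_inverse .
    qed
    fix t :: real assume t: "0 \<le> t"
    have "((\<lambda>t. - (2 * s\<^sup>2 * C) * exp (- (t\<^sup>2 / (4 * s\<^sup>2)))) has_real_derivative
        - (2 * s\<^sup>2 * C) * (exp (- (t\<^sup>2 / (4 * s\<^sup>2))) * - (2 * t / (4 * s\<^sup>2)))) (at t)"
      using assms by (auto intro!: derivative_eq_intros)
    also have "- (2 * s\<^sup>2 * C) * (exp (- (t\<^sup>2 / (4 * s\<^sup>2))) * - (2 * t / (4 * s\<^sup>2)))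
        = C * (t * exp (- (t\<^sup>2 / (4 * s\<^sup>2))))"
      using assms by simp
    finally show "((\<lambda>t. - (2 * s\<^sup>2 * C) * exp (- (t\<^sup>2 / (4 * s\<^sup>2)))) has_real_derivative
        C * (t * exp (- (t\<^sup>2 / (4 * s\<^sup>2))))) (at t)" .
    show "0 \<le> C * (t * exp (- (t\<^sup>2 / (4 * s\<^sup>2))))" using t C by simp
  qed measurable
  also have "0 - (- (2 * s\<^sup>2 * C) * exp (- (0\<^sup>2 / (4 * s\<^sup>2)))) = 4 * (l\<^sup>2 * s\<^sup>2) * exp (l\<^sup>2 * s\<^sup>2)"
    by (simp add: C_def)
  finally show ?thesis .
qed

text \<open>
  The proof goes through the defining property of conditional expectation for nonnegative functions,
  which carries an arbitrary weight \<open>H\<close>. The passage from the real-valued to the extended conditional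
  probability needs that the latter is finite; it is at most \<open>1\<close> almost everywhere.
\<close>

lemma (in sigma_finite_subalgebra) nn_integral_indicator_le_of_cond_prob:
  fixes H :: "'a \<Rightarrow> ennreal" and g :: "'a \<Rightarrow> real"
  assumes [measurable]: "H \<in> borel_measurable F" "g \<in> borel_measurable F" "A \<in> sets M"
    and le: "AE \<omega> in M. cond_prob_given M F A \<omega> \<le> g \<omega>"
  shows "(\<integral>\<^sup>+\<omega>. H \<omega> * indicator A \<omega> \<partial>M) \<le> (\<integral>\<^sup>+\<omega>. H \<omega> * ennreal (g \<omega>) \<partial>M)"
proof -
  have "AE \<omega> in M. nn_cond_exp M F (indicator A) \<omega> \<le> nn_cond_exp M F (\<lambda>_. 1) \<omega>"
    by (rule nn_cond_exp_mono) (auto split: split_indicator)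
  moreover have "AE \<omega> in M. 1 = nn_cond_exp M F (\<lambda>_. 1) \<omega>"
    by (rule nn_cond_exp_F_meas) simp
  moreover have "AE \<omega> in M. 0 = nn_cond_exp M F (\<lambda>_. 0) \<omega>"
    by (rule nn_cond_exp_F_meas) simp
  ultimately have "AE \<omega> in M. nn_cond_exp M F (indicator A) \<omega> \<le> ennreal (g \<omega>)"
    using le
  proof eventually_elim
    case (elim \<omega>)
    have "(\<lambda>x. ennreal (indicator A x)) = indicator A" "(\<lambda>x. ennreal (- indicator A x)) = (\<lambda>_. 0)"
      by (auto simp: indicator_def ennreal_neg)
    then have "cond_prob_given M F A \<omega> = enn2real (nn_cond_exp M F (indicator A) \<omega>)"
      using elim by (simp add: cond_prob_given_def real_cond_exp_def)
    then show ?case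
      using elim by (metis ennreal_enn2real ennreal_leI ennreal_one_less_top order_le_less_trans)
  qed
  then have "(\<integral>\<^sup>+\<omega>. H \<omega> * nn_cond_exp M F (indicator A) \<omega> \<partial>M) \<le> (\<integral>\<^sup>+\<omega>. H \<omega> * ennreal (g \<omega>) \<partial>M)"
    by (intro nn_integral_mono_AE) (auto elim!: eventually_mono intro: mult_left_mono)
  then show ?thesis by (simp add: nn_cond_exp_intg)
qed

text \<open>
  This is the conditional moment bound
  \<open>E[exp (l R) - l R | F] \<le> exp (5 l\<^sup>2 s\<^sup>2)\<close>, tested against nonnegative \<open>F\<close>-measurable weights \<open>H\<close>.
  The tail hypothesis holds for each \<open>t\<close> outside a null set that depends on \<open>t\<close>, and the testing
  form gets around this: Tonelli's theorem moves the integral over \<open>t\<close> outside, the tail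
  bound is applied for one \<open>t\<close> at a time, and Tonelli's theorem moves the integral back inside.
\<close>

lemma (in sigma_finite_subalgebra) nn_integral_exp_le_of_subGaussian_tail:
  fixes H :: "'a \<Rightarrow> ennreal" and R s :: "'a \<Rightarrow> real"
  assumes HF: "H \<in> borel_measurable F" and sF: "s \<in> borel_measurable F"
    and [measurable]: "R \<in> borel_measurable M"
    and R: "\<And>\<omega>. 0 \<le> R \<omega>" and s: "\<And>\<omega>. \<omega> \<in> space M \<Longrightarrow> 0 < s \<omega>" and l: "0 \<le> l"
    and tail: "\<And>t. 0 \<le> t \<Longrightarrow>
       AE \<omega> in M. cond_prob_given M F {\<omega> \<in> space M. t \<le> R \<omega>} \<omega> \<le> 2 * exp (- (t\<^sup>2 / (2 * (s \<omega>)\<^sup>2)))"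
  shows "(\<integral>\<^sup>+\<omega>. H \<omega> * ennreal (exp (l * R \<omega>) - l * R \<omega>) \<partial>M)
           \<le> (\<integral>\<^sup>+\<omega>. H \<omega> * ennreal (exp (5 * (l\<^sup>2 * (s \<omega>)\<^sup>2))) \<partial>M)"
proof -
  interpret pair_sigma_finite M lborel by standard
  have qF: "(\<lambda>\<omega>. 2 * exp (- (t\<^sup>2 / (2 * (s \<omega>)\<^sup>2)))) \<in> borel_measurable F" for t
  proof -
    note [measurable] = sF
    show ?thesis by measurable
  qed
  note [measurable] = measurable_from_subalg[OF subalg HF] measurable_from_subalg[OF subalg sF]
  define w where "w t = ennreal (l * (exp (l * t) - 1)) * indicator {0..} t" for t :: real
  define q where "q t \<omega> = ennreal (2 * exp (- (t\<^sup>2 / (2 * (s \<omega>)\<^sup>2))))" for t \<omega>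
  have [measurable]: "w \<in> borel_measurable borel" unfolding w_def by measurable
  have [measurable]: "(\<lambda>(\<omega>, t). q t \<omega>) \<in> borel_measurable (M \<Otimes>\<^sub>M borel)"
    unfolding q_def by measurable
  have layer: "ennreal (exp (l * R \<omega>) - l * R \<omega>)
      = 1 + (\<integral>\<^sup>+t. w t * indicator {\<omega> \<in> space M. t \<le> R \<omega>} \<omega> \<partial>lborel)" if "\<omega> \<in> space M" for \<omega>
  proof -
    have "(\<integral>\<^sup>+t. w t * indicator {\<omega> \<in> space M. t \<le> R \<omega>} \<omega> \<partial>lborel)
        = (\<integral>\<^sup>+t. ennreal (l * (exp (l * t) - 1)) * indicator {0..R \<omega>} t \<partial>lborel)"
      using that by (intro nn_integral_cong) (auto simp: w_def split: split_indicator)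
    also have "\<dots> = ennreal (exp (l * R \<omega>) - l * R \<omega> - 1)"
      using R l by (rule nn_integral_exp_layer_cake)
    also have "1 + \<dots> = ennreal (1 + (exp (l * R \<omega>) - l * R \<omega> - 1))"
      using exp_ge_add_one_self[of "l * R \<omega>"]
      by (subst ennreal_plus) (auto simp: algebra_simps simp del: exp_ge_add_one_self)
    finally show ?thesis by simp
  qed
  have "(\<integral>\<^sup>+\<omega>. H \<omega> * ennreal (exp (l * R \<omega>) - l * R \<omega>) \<partial>M)
      = (\<integral>\<^sup>+\<omega>. H \<omega> + (\<integral>\<^sup>+t. w t * (H \<omega> * indicator {\<omega> \<in> space M. t \<le> R \<omega>} \<omega>) \<partial>lborel) \<partial>M)"
    by (intro nn_integral_cong)
       (simp add: layer distrib_left nn_integral_cmult[symmetric] mult_ac)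
  also have "\<dots> = (\<integral>\<^sup>+\<omega>. H \<omega> \<partial>M)
      + (\<integral>\<^sup>+\<omega>. (\<integral>\<^sup>+t. w t * (H \<omega> * indicator {\<omega> \<in> space M. t \<le> R \<omega>} \<omega>) \<partial>lborel) \<partial>M)"
    by (rule nn_integral_add) measurable
  also have "(\<integral>\<^sup>+\<omega>. (\<integral>\<^sup>+t. w t * (H \<omega> * indicator {\<omega> \<in> space M. t \<le> R \<omega>} \<omega>) \<partial>lborel) \<partial>M)
      = (\<integral>\<^sup>+t. (\<integral>\<^sup>+\<omega>. w t * (H \<omega> * indicator {\<omega> \<in> space M. t \<le> R \<omega>} \<omega>) \<partial>M) \<partial>lborel)"
    by (rule Fubini'[symmetric]) measurable
  also have "\<dots> \<le> (\<integral>\<^sup>+t. (\<integral>\<^sup>+\<omega>. w t * (H \<omega> * q t \<omega>) \<partial>M) \<partial>lborel)"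
  proof (rule nn_integral_mono)
    fix t :: real
    show "(\<integral>\<^sup>+\<omega>. w t * (H \<omega> * indicator {\<omega> \<in> space M. t \<le> R \<omega>} \<omega>) \<partial>M)
        \<le> (\<integral>\<^sup>+\<omega>. w t * (H \<omega> * q t \<omega>) \<partial>M)"
    proof (cases "0 \<le> t")
      case True
      have "(\<integral>\<^sup>+\<omega>. H \<omega> * indicator {\<omega> \<in> space M. t \<le> R \<omega>} \<omega> \<partial>M) \<le> (\<integral>\<^sup>+\<omega>. H \<omega> * q t \<omega> \<partial>M)"
        unfolding q_def
        by (rule nn_integral_indicator_le_of_cond_prob[OF HF qF _ tail[OF True]]) measurable
      then show ?thesis
        by (simp add: nn_integral_cmult q_def mult_left_mono)
    qed (simp add: w_def)
  qed
  also have "\<dots> = (\<integral>\<^sup>+\<omega>. (\<integral>\<^sup>+t. w t * (H \<omega> * q t \<omega>) \<partial>lborel) \<partial>M)"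
    by (rule Fubini') measurable
  also have "(\<integral>\<^sup>+\<omega>. H \<omega> \<partial>M) + \<dots> = (\<integral>\<^sup>+\<omega>. H \<omega> + (\<integral>\<^sup>+t. w t * (H \<omega> * q t \<omega>) \<partial>lborel) \<partial>M)"
    by (rule nn_integral_add[symmetric]) measurable
  also have "\<dots> \<le> (\<integral>\<^sup>+\<omega>. H \<omega> * ennreal (exp (5 * (l\<^sup>2 * (s \<omega>)\<^sup>2))) \<partial>M)"
  proof (rule nn_integral_mono)
    fix \<omega> assume \<omega>: "\<omega> \<in> space M"
    let ?x = "l\<^sup>2 * (s \<omega>)\<^sup>2"
    have "H \<omega> + (\<integral>\<^sup>+t. w t * (H \<omega> * q t \<omega>) \<partial>lborel) = H \<omega> * (1 + (\<integral>\<^sup>+t. w t * q t \<omega> \<partial>lborel))"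
      by (simp add: distrib_left nn_integral_cmult[symmetric] mult_ac q_def)
    also have "\<dots> \<le> H \<omega> * (1 + ennreal (4 * ?x * exp ?x))"
      unfolding w_def q_def using s[OF \<omega>] l
      by (intro mult_left_mono add_left_mono nn_integral_gaussian_layer_le) auto
    also have "1 + ennreal (4 * ?x * exp ?x) = ennreal (1 + 4 * ?x * exp ?x)"
      by (subst ennreal_plus) auto
    also have "H \<omega> * \<dots> \<le> H \<omega> * ennreal (exp (5 * ?x))"
      by (intro mult_left_mono ennreal_leI one_plus_mult_exp_le_exp) auto
    finally show "H \<omega> + (\<integral>\<^sup>+t. w t * (H \<omega> * q t \<omega>) \<partial>lborel) \<le> H \<omega> * ennreal (exp (5 * ?x))" .
  qed
  finally show ?thesis by (simp add: add_left_mono)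
qed

section \<open>The exponential supermartingale\<close>

lemma two_mult_le_exp: "2 * x \<le> exp x" if "0 \<le> x" for x :: real
proof -
  have "0 \<le> (x - 1)\<^sup>2" by simp
  then have "2 * x \<le> 1 + x + x\<^sup>2 / 2"
    by (simp add: power2_eq_square algebra_simps)
  also have "\<dots> \<le> exp x" using exp_lower_Taylor_quadratic[OF that] .
  finally show ?thesis .
qed

text \<open>
  Integrate \<open>cosh_L2_set_add_le\<close> with \<open>s = S\<close> and \<open>x = X\<close>. The terms linear in the coordinates
  of \<open>X\<close> have conditional mean zero, and the others are controlled by
  \<open>nn_integral_exp_le_of_subGaussian_tail\<close>, at the price of the factor \<open>exp (5 l\<^sup>2 s\<^sup>2)\<close>.
  As \<open>s\<close> is random and may be unbounded, a coordinate of \<open>X\<close> can fail to be integrable. The weighted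
  linear terms \<open>Y k * X k\<close> are nevertheless integrable: \<open>sinh (l a) \<le> cosh (l a)\<close> and
  \<open>2 l R \<le> exp (l R)\<close> bound them by \<open>G\<close>, whose integral is already known to be finite.
\<close>

lemma (in sigma_finite_subalgebra) cosh_norm_supermartingale_step:
  fixes S X :: "'a \<Rightarrow> 'k \<Rightarrow> real" and s W :: "'a \<Rightarrow> real" and l :: real
  assumes A: "finite A" and l: "0 \<le> l"
    and SF: "\<And>k. k \<in> A \<Longrightarrow> (\<lambda>\<omega>. S \<omega> k) \<in> borel_measurable F"
    and XM[measurable]: "\<And>k. k \<in> A \<Longrightarrow> (\<lambda>\<omega>. X \<omega> k) \<in> borel_measurable M"
    and WF: "W \<in> borel_measurable F" and W: "\<And>\<omega>. 0 \<le> W \<omega>"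
    and sF: "s \<in> borel_measurable F" and s: "\<And>\<omega>. \<omega> \<in> space M \<Longrightarrow> 0 < s \<omega>"
    and mean: "\<And>k. k \<in> A \<Longrightarrow> AE \<omega> in M. real_cond_exp M F (\<lambda>\<omega>. X \<omega> k) \<omega> = 0"
    and tail: "\<And>t. 0 \<le> t \<Longrightarrow> AE \<omega> in M.
       cond_prob_given M F {\<omega> \<in> space M. t \<le> L2_set (X \<omega>) A} \<omega> \<le> 2 * exp (- (t\<^sup>2 / (2 * (s \<omega>)\<^sup>2)))"
    and int: "integrable M (\<lambda>\<omega>. W \<omega> * exp (5 * (l\<^sup>2 * (s \<omega>)\<^sup>2)) * cosh (l * L2_set (S \<omega>) A))"
  shows "integrable M (\<lambda>\<omega>. W \<omega> * cosh (l * L2_set (\<lambda>k. S \<omega> k + X \<omega> k) A))"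
    and "(\<integral>\<omega>. W \<omega> * cosh (l * L2_set (\<lambda>k. S \<omega> k + X \<omega> k) A) \<partial>M)
           \<le> (\<integral>\<omega>. W \<omega> * exp (5 * (l\<^sup>2 * (s \<omega>)\<^sup>2)) * cosh (l * L2_set (S \<omega>) A) \<partial>M)"
proof -
  define a where "a \<omega> = L2_set (S \<omega>) A" for \<omega>
  define R where "R \<omega> = L2_set (X \<omega>) A" for \<omega>
  define H where "H \<omega> = W \<omega> * cosh (l * a \<omega>)" for \<omega>
  define G where "G \<omega> = H \<omega> * (exp (l * R \<omega>) - l * R \<omega>)" for \<omega>
  define Y where "Y k \<omega> = W \<omega> * (l * (sinh (l * a \<omega>) / a \<omega>) * S \<omega> k)" for k \<omega>
  let ?E = "\<lambda>\<omega>. W \<omega> * exp (5 * (l\<^sup>2 * (s \<omega>)\<^sup>2)) * cosh (l * L2_set (S \<omega>) A)"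
  have F_meas: "H \<in> borel_measurable F" "k \<in> A \<Longrightarrow> Y k \<in> borel_measurable F" for k
  proof -
    note [measurable] = SF WF
    show "H \<in> borel_measurable F" "k \<in> A \<Longrightarrow> Y k \<in> borel_measurable F"
      unfolding H_def Y_def a_def L2_set_def cosh_def sinh_def by measurable
  qed
  note [measurable] = measurable_from_subalg[OF subalg F_meas(1)]
    measurable_from_subalg[OF subalg F_meas(2)] measurable_from_subalg[OF subalg SF]
    measurable_from_subalg[OF subalg WF]
  have R_meas [measurable]: "R \<in> borel_measurable M"
    unfolding R_def L2_set_def by measurable
  have R: "0 \<le> R \<omega>" and a: "0 \<le> a \<omega>" for \<omega> by (simp_all add: R_def a_def)
  have H: "0 \<le> H \<omega>" for \<omega> using W by (simp add: H_def)
  have "l * R \<omega> \<le> exp (l * R \<omega>)" for \<omega>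
    using exp_ge_add_one_self[of "l * R \<omega>"] by linarith
  then have G: "0 \<le> G \<omega>" for \<omega> using H by (simp add: G_def)
  have E_eq: "?E \<omega> = H \<omega> * exp (5 * (l\<^sup>2 * (s \<omega>)\<^sup>2))" for \<omega>
    by (simp add: H_def a_def)
  have "(\<integral>\<^sup>+\<omega>. ennreal (G \<omega>) \<partial>M)
      = (\<integral>\<^sup>+\<omega>. ennreal (H \<omega>) * ennreal (exp (l * R \<omega>) - l * R \<omega>) \<partial>M)"
    by (simp add: G_def ennreal_mult' H)
  also have "\<dots> \<le> (\<integral>\<^sup>+\<omega>. ennreal (H \<omega>) * ennreal (exp (5 * (l\<^sup>2 * (s \<omega>)\<^sup>2))) \<partial>M)"
    using F_meas(1) sF R s l tail unfolding R_def[symmetric]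
    by (intro nn_integral_exp_le_of_subGaussian_tail) auto
  also have "\<dots> = (\<integral>\<^sup>+\<omega>. ennreal (?E \<omega>) \<partial>M)"
    unfolding E_eq by (simp add: ennreal_mult' H)
  also have "\<dots> = ennreal (\<integral>\<omega>. ?E \<omega> \<partial>M)"
    using W by (intro nn_integral_eq_integral int) auto
  finally have nnG: "(\<integral>\<^sup>+\<omega>. ennreal (G \<omega>) \<partial>M) \<le> ennreal (\<integral>\<omega>. ?E \<omega> \<partial>M)" .
  have G_int: "integrable M G"
    using nnG G by (intro integrableI_nonneg) (auto simp: G_def[abs_def] less_top[symmetric] top_unique)
  have "ennreal (\<integral>\<omega>. G \<omega> \<partial>M) \<le> ennreal (\<integral>\<omega>. ?E \<omega> \<partial>M)"
    using nnG nn_integral_eq_integral[OF G_int] G by simp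
  then have G_le: "(\<integral>\<omega>. G \<omega> \<partial>M) \<le> (\<integral>\<omega>. ?E \<omega> \<partial>M)"
    using W by (subst (asm) ennreal_le_iff) (auto intro!: integral_nonneg_AE)
  have YX_int: "integrable M (\<lambda>\<omega>. Y k \<omega> * X \<omega> k)" if k: "k \<in> A" for k
  proof (rule Bochner_Integration.integrable_bound[OF G_int])
    show "AE \<omega> in M. norm (Y k \<omega> * X \<omega> k) \<le> norm (G \<omega>)"
    proof (rule AE_I2)
      fix \<omega>
      have S_le: "\<bar>S \<omega> k\<bar> \<le> a \<omega>" and X_le: "\<bar>X \<omega> k\<bar> \<le> R \<omega>"
        using member_le_L2_set[OF A k, of "\<lambda>k. \<bar>S \<omega> k\<bar>"] member_le_L2_set[OF A k, of "\<lambda>k. \<bar>X \<omega> k\<bar>"]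
        by (simp_all add: a_def R_def L2_set_def)
      have "\<bar>sinh (l * a \<omega>) / a \<omega> * S \<omega> k\<bar> = sinh (l * a \<omega>) * (\<bar>S \<omega> k\<bar> / a \<omega>)"
        using a[of \<omega>] l by (simp add: abs_mult)
      also have "\<dots> \<le> sinh (l * a \<omega>) * 1"
        using a[of \<omega>] l S_le by (intro mult_left_mono) (auto simp: divide_le_eq_1)
      also have "\<dots> \<le> cosh (l * a \<omega>)" using sinh_less_cosh_real[of "l * a \<omega>"] by simp
      finally have "\<bar>sinh (l * a \<omega>) / a \<omega> * S \<omega> k\<bar> * \<bar>X \<omega> k\<bar> \<le> cosh (l * a \<omega>) * R \<omega>"
        using X_le by (intro mult_mono) auto
      then have "(W \<omega> * l) * (\<bar>sinh (l * a \<omega>) / a \<omega> * S \<omega> k\<bar> * \<bar>X \<omega> k\<bar>) \<le> (W \<omega> * l) * (cosh (l * a \<omega>) * R \<omega>)"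
        using W l by (intro mult_left_mono) auto
      then have "\<bar>Y k \<omega> * X \<omega> k\<bar> \<le> H \<omega> * (l * R \<omega>)"
        using W[of \<omega>] l by (simp add: Y_def H_def abs_mult mult_ac)
      also have "\<dots> \<le> G \<omega>"
        unfolding G_def using two_mult_le_exp[of "l * R \<omega>"] l R[of \<omega>] H by (intro mult_left_mono) auto
      finally show "norm (Y k \<omega> * X \<omega> k) \<le> norm (G \<omega>)" by simp
    qed
  qed (use k in measurable)
  \<comment> \<open>The weight belongs to the past, so the increment may be replaced by its conditional mean.\<close>
  have YX_zero: "(\<integral>\<omega>. Y k \<omega> * X \<omega> k \<partial>M) = 0" if k: "k \<in> A" for k
  proof -
    have "(\<integral>\<omega>. Y k \<omega> * X \<omega> k \<partial>M) = (\<integral>\<omega>. Y k \<omega> * real_cond_exp M F (\<lambda>\<omega>. X \<omega> k) \<omega> \<partial>M)"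
      using k by (intro real_cond_exp_intg(2)[symmetric] YX_int F_meas XM)
    also have "\<dots> = (\<integral>\<omega>. 0 \<partial>M)"
      using mean[OF k] k by (intro integral_cong_AE) auto
    finally show ?thesis by simp
  qed
  have le: "W \<omega> * cosh (l * L2_set (\<lambda>k. S \<omega> k + X \<omega> k) A) \<le> G \<omega> + (\<Sum>k\<in>A. Y k \<omega> * X \<omega> k)" for \<omega>
    using mult_left_mono[OF cosh_L2_set_add_le[OF A l, of "S \<omega>" "X \<omega>"] W[of \<omega>]]
    by (simp add: G_def H_def Y_def a_def R_def distrib_left sum_distrib_left mult_ac)
  have bound_int: "integrable M (\<lambda>\<omega>. G \<omega> + (\<Sum>k\<in>A. Y k \<omega> * X \<omega> k))"
    using G_int YX_int by auto
  show int': "integrable M (\<lambda>\<omega>. W \<omega> * cosh (l * L2_set (\<lambda>k. S \<omega> k + X \<omega> k) A))"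
  proof (rule Bochner_Integration.integrable_bound[OF bound_int])
    show "(\<lambda>\<omega>. W \<omega> * cosh (l * L2_set (\<lambda>k. S \<omega> k + X \<omega> k) A)) \<in> borel_measurable M"
      unfolding L2_set_def cosh_def by measurable
    show "AE \<omega> in M. norm (W \<omega> * cosh (l * L2_set (\<lambda>k. S \<omega> k + X \<omega> k) A))
        \<le> norm (G \<omega> + (\<Sum>k\<in>A. Y k \<omega> * X \<omega> k))"
      using le W by (intro AE_I2) (simp add: order_trans[OF le abs_ge_self])
  qed
  have "(\<integral>\<omega>. W \<omega> * cosh (l * L2_set (\<lambda>k. S \<omega> k + X \<omega> k) A) \<partial>M)
      \<le> (\<integral>\<omega>. G \<omega> + (\<Sum>k\<in>A. Y k \<omega> * X \<omega> k) \<partial>M)"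
    by (intro integral_mono int' bound_int le)
  also have "\<dots> = (\<integral>\<omega>. G \<omega> \<partial>M)"
    using G_int YX_int YX_zero by (simp add: Bochner_Integration.integral_sum)
  also note G_le
  finally show "(\<integral>\<omega>. W \<omega> * cosh (l * L2_set (\<lambda>k. S \<omega> k + X \<omega> k) A) \<partial>M) \<le> (\<integral>\<omega>. ?E \<omega> \<partial>M)" .
qed

section \<open>The filtration generated by the vectors\<close>

lemma space_generated_algebra [simp]: "space (generated_algebra M d X i) = space M"
  unfolding generated_algebra_def by (subst space_measure_of) auto

lemma sets_generated_algebra:
  "sets (generated_algebra M d X i)
     = sigma_sets (space M) (\<Union>j\<in>{1..i}. {X j -` A \<inter> space M | A. A \<in> sets (borel_vec d)})"
  unfolding generated_algebra_def by (subst sets_measure_of) auto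

lemma subalgebra_generated_algebra:
  assumes "\<And>j. j \<in> {1..i} \<Longrightarrow> X j \<in> measurable M (borel_vec d)"
  shows "subalgebra M (generated_algebra M d X i)"
  unfolding subalgebra_def sets_generated_algebra
  using assms by (auto intro!: sets.sigma_sets_subset measurable_sets)

lemma measurable_generated_algebra:
  assumes "X j \<in> measurable M (borel_vec d)" "j \<in> {1..i}"
  shows "X j \<in> measurable (generated_algebra M d X i) (borel_vec d)"
proof (rule measurableI)
  fix A assume "A \<in> sets (borel_vec d)"
  then show "X j -` A \<inter> space (generated_algebra M d X i) \<in> sets (generated_algebra M d X i)"
    unfolding sets_generated_algebra space_generated_algebra
    by (intro sigma_sets.Basic UN_I[OF assms(2)]) blast
qed (use measurable_space[OF assms(1)] in simp)

lemma measurable_generated_algebra_mono: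
  assumes "f \<in> measurable (generated_algebra M d X i) N" "i \<le> i'"
  shows "f \<in> measurable (generated_algebra M d X i') N"
proof (rule measurable_from_subalg[OF _ assms(1)])
  show "subalgebra (generated_algebra M d X i') (generated_algebra M d X i)"
    unfolding subalgebra_def sets_generated_algebra space_generated_algebra
    using assms(2) by (intro conjI refl sigma_sets_mono' UN_mono) auto
qed

lemma measurable_coordinate:
  "f \<in> measurable N (borel_vec d) \<Longrightarrow> k < d \<Longrightarrow> (\<lambda>\<omega>. f \<omega> k) \<in> borel_measurable N"
  by (erule measurable_compose[OF _ measurable_component_singleton]) simp

text \<open>
  The scale of the next increment is known from the past, so the factor \<open>exp (5 l\<^sup>2 (\<sigma> (m + 1))\<^sup>2)\<close>
  that \<open>cosh_norm_supermartingale_step\<close> costs can be paid in advance: the weight \<open>W\<close> below already contains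
  the new term of the sum of the \<open>(\<sigma> i)\<^sup>2\<close>. Integrability has to be carried along the induction,
  because the step requires it.
\<close>

lemma cosh_supermartingale_expectation_le_1:
  assumes M: "prob_space M" and mds: "norm_subGaussian_mds M d n X \<sigma>" and l: "0 \<le> l" and "m \<le> n"
  shows "integrable M (\<lambda>\<omega>. exp (- (5 * l\<^sup>2 * (\<Sum>i=1..m. (\<sigma> i \<omega>)\<^sup>2)))
             * cosh (l * L2_set (\<lambda>k. \<Sum>i=1..m. X i \<omega> k) {..<d}))
       \<and> (\<integral>\<omega>. exp (- (5 * l\<^sup>2 * (\<Sum>i=1..m. (\<sigma> i \<omega>)\<^sup>2)))
             * cosh (l * L2_set (\<lambda>k. \<Sum>i=1..m. X i \<omega> k) {..<d}) \<partial>M) \<le> 1"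
  using \<open>m \<le> n\<close>
proof (induction m)
  case 0
  interpret prob_space M by fact
  show ?case by (simp add: L2_set_def prob_space)
next
  case (Suc m)
  interpret prob_space M by fact
  let ?F = "generated_algebra M d X m"
  have X: "X i \<in> measurable M (borel_vec d)"
    and \<sigma>: "\<sigma> i \<in> borel_measurable (generated_algebra M d X (i - 1))" if "i \<in> {1..Suc m}" for i
    using mds that Suc.prems by (auto simp: norm_subGaussian_mds_def)
  have last: "\<And>\<omega>. \<omega> \<in> space M \<Longrightarrow> 0 < \<sigma> (Suc m) \<omega>"
    "\<And>k. k \<in> {..<d} \<Longrightarrow> AE \<omega> in M. real_cond_exp M ?F (\<lambda>\<omega>. X (Suc m) \<omega> k) \<omega> = 0"
    "\<And>t. 0 \<le> t \<Longrightarrow> AE \<omega> in M.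
       cond_prob_given M ?F {\<omega> \<in> space M. t \<le> L2_set (X (Suc m) \<omega>) {..<d}} \<omega>
         \<le> 2 * exp (- (t\<^sup>2 / (2 * (\<sigma> (Suc m) \<omega>)\<^sup>2)))"
    using mds[unfolded norm_subGaussian_mds_def, rule_format, of "Suc m"] Suc.prems by auto
  have F: "subalgebra M ?F"
    using X by (intro subalgebra_generated_algebra) auto
  interpret finite_measure_subalgebra M ?F
    by unfold_locales (rule F)
  have \<sigma>F: "\<sigma> i \<in> borel_measurable ?F" if "i \<in> {1..Suc m}" for i
    using measurable_generated_algebra_mono[OF \<sigma>[OF that], of m] that by auto
  define S where "S \<omega> k = (\<Sum>i=1..m. X i \<omega> k)" for \<omega> k
  define W where "W \<omega> = exp (- (5 * l\<^sup>2 * (\<Sum>i=1..Suc m. (\<sigma> i \<omega>)\<^sup>2)))" for \<omega>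
  have SF: "(\<lambda>\<omega>. S \<omega> k) \<in> borel_measurable ?F" if "k \<in> {..<d}" for k
    unfolding S_def using that X
    by (intro borel_measurable_sum measurable_coordinate[of _ _ d] measurable_generated_algebra) auto
  have WF: "W \<in> borel_measurable ?F"
  proof -
    note [measurable] = \<sigma>F
    show ?thesis unfolding W_def by measurable
  qed
  have XM: "(\<lambda>\<omega>. X (Suc m) \<omega> k) \<in> borel_measurable M" if "k \<in> {..<d}" for k
    using that X[of "Suc m"] by (intro measurable_coordinate[of _ _ d]) auto
  have W_eq: "W \<omega> * exp (5 * (l\<^sup>2 * (\<sigma> (Suc m) \<omega>)\<^sup>2)) = exp (- (5 * l\<^sup>2 * (\<Sum>i=1..m. (\<sigma> i \<omega>)\<^sup>2)))" for \<omega>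
    by (simp add: W_def mult_exp_exp distrib_left)
  have "integrable M (\<lambda>\<omega>. W \<omega> * exp (5 * (l\<^sup>2 * (\<sigma> (Suc m) \<omega>)\<^sup>2)) * cosh (l * L2_set (S \<omega>) {..<d}))"
    using Suc by (simp add: W_eq S_def[abs_def])
  note step = cosh_norm_supermartingale_step[OF finite_lessThan l SF XM WF _ \<sigma>F last this]
  have S_Suc: "(\<lambda>k. \<Sum>i=1..Suc m. X i \<omega> k) = (\<lambda>k. S \<omega> k + X (Suc m) \<omega> k)" for \<omega>
    by (simp add: S_def)
  have "(\<integral>\<omega>. W \<omega> * exp (5 * (l\<^sup>2 * (\<sigma> (Suc m) \<omega>)\<^sup>2)) * cosh (l * L2_set (S \<omega>) {..<d}) \<partial>M) \<le> 1"
    using Suc by (simp add: W_eq S_def[abs_def])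
  then show ?case
    unfolding S_Suc W_def[symmetric] using step by (auto simp: W_def)
qed

section \<open>Dyadic scales for the total variance\<close>

text \<open>
  With \<open>x = B / b\<close>, this many dyadic intervals starting at \<open>b\<close> cover \<open>[b, B)\<close>. Taking the logarithm
  of this count in the union bound is what produces the iterated logarithm. The cutoff at \<open>0\<close>
  accounts for the one interval that is needed even when \<open>x\<close> is close to \<open>1\<close>.
\<close>

lemma card_dyadic_scales_le:
  fixes x :: real
  assumes "1 < x"
  shows "real (nat \<lfloor>log 2 x\<rfloor> + 1) \<le> 3 * exp (max 0 (ln (ln x)))"
proof -
  have "0 < ln x" using assms by simp
  then have 1: "ln x \<le> exp (max 0 (ln (ln x)))"
    using exp_le_cancel_iff[of "ln (ln x)" "max 0 (ln (ln x))"] by simp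
  have "real (nat \<lfloor>log 2 x\<rfloor>) \<le> log 2 x"
    using assms by (simp add: zero_le_log_cancel_iff)
  also have "\<dots> \<le> 2 * ln x"
  proof -
    have "ln x * 1 \<le> ln x * (2 * ln 2)"
      using \<open>0 < ln x\<close> ln2_ge_two_thirds by (intro mult_left_mono) auto
    then show ?thesis by (simp add: log_def field_simps)
  qed
  finally have "real (nat \<lfloor>log 2 x\<rfloor> + 1) \<le> 2 * ln x + 1" by simp
  also have "\<dots> \<le> 2 * exp (max 0 (ln (ln x))) + exp (max 0 (ln (ln x)))"
    using 1 by (intro add_mono) auto
  finally show ?thesis by simp
qed

lemma dyadic_scale_exists:
  fixes x y :: real
  assumes "1 \<le> y" "y \<le> x"
  obtains k where "k < nat \<lfloor>log 2 x\<rfloor> + 1" "2 ^ k \<le> y" "y < 2 * 2 ^ k"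
proof
  show "nat \<lfloor>log 2 y\<rfloor> < nat \<lfloor>log 2 x\<rfloor> + 1"
    using assms by (simp add: less_Suc_eq_le nat_mono floor_mono)
  have "0 \<le> log 2 y" using assms by simp
  then have "real (nat \<lfloor>log 2 y\<rfloor>) \<le> log 2 y" "log 2 y < real (nat \<lfloor>log 2 y\<rfloor>) + 1"
    by linarith+
  then have "2 powr real (nat \<lfloor>log 2 y\<rfloor>) \<le> y" "y < 2 powr (real (nat \<lfloor>log 2 y\<rfloor>) + 1)"
    using assms by (simp_all only: le_log_iff log_less_iff)
  then show "2 ^ nat \<lfloor>log 2 y\<rfloor> \<le> y" "y < 2 * 2 ^ nat \<lfloor>log 2 y\<rfloor>"
    by (simp_all only: powr_add powr_realpow powr_one mult.commute zero_less_numeral zero_le_numeral)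
qed

text \<open>
  A bound on the exponential process at one scale \<open>v\<close> of the variance \<open>V\<close> gives
  \<open>l N \<le> q + 5 l\<^sup>2 V\<close>, because \<open>exp x \<le> 2 cosh x\<close>. The value \<open>l = sqrt (q / v)\<close> balances the two terms up to
  a constant as long as \<open>V\<close> is at most of the order of \<open>v\<close>: then the right-hand side is at most
  \<open>11 q\<close>.
\<close>

lemma norm_le_of_cosh_le:
  fixes q v N V r :: real
  assumes "0 < q" "0 < v" "0 \<le> N" "V \<le> 2 * v" "0 < r"
    and le: "exp (- (5 * (sqrt (q / v))\<^sup>2 * V)) * cosh (sqrt (q / v) * N) \<le> r"
    and q: "q = ln (2 * r)"
  shows "N \<le> 11 * sqrt (q * v)"
proof -
  let ?l = "sqrt (q / v)"
  have "exp (?l * N) \<le> 2 * cosh (?l * N)" by (simp add: cosh_field_def)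
  also have "\<dots> = 2 * (exp (- (5 * ?l\<^sup>2 * V)) * cosh (?l * N)) * exp (5 * ?l\<^sup>2 * V)"
    by (simp add: exp_minus)
  also have "\<dots> \<le> 2 * r * exp (5 * ?l\<^sup>2 * V)"
    using le by (intro mult_right_mono mult_left_mono) auto
  also have "2 * r = exp q" using assms by simp
  finally have "?l * N \<le> q + 5 * ?l\<^sup>2 * V" by (simp add: mult_exp_exp)
  also have "5 * ?l\<^sup>2 * V \<le> 5 * ?l\<^sup>2 * (2 * v)" using assms by (intro mult_left_mono) auto
  also have "5 * ?l\<^sup>2 * (2 * v) = 10 * q" using assms by simp
  finally have "?l * N \<le> 11 * q" by simp
  also have "\<dots> = ?l * (11 * sqrt (q * v))"
    using assms by (simp add: real_sqrt_divide real_sqrt_mult)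
  finally show ?thesis using assms by (simp add: mult_le_cancel_left_pos)
qed

text \<open>
  The left-hand side is the exponent that the union bound asks for. Its additive constant \<open>ln 3\<close> is
  absorbed by \<open>ln (2 d / \<delta>)\<close>, which is at least \<open>ln 2\<close>.
\<close>

lemma ln_card_dyadic_scales_le:
  fixes d :: nat and \<delta> x :: real
  assumes "1 \<le> d" "0 < \<delta>" "\<delta> < 1" "1 < x"
  shows "ln (2 * (real (nat \<lfloor>log 2 x\<rfloor> + 1) / \<delta>)) \<le> 4 * (ln (2 * real d / \<delta>) + max 0 (ln (ln x)))"
proof -
  let ?L = "max 0 (ln (ln x))"
  define D where "D = 2 * real d / \<delta>"
  define K where "K = real (nat \<lfloor>log 2 x\<rfloor> + 1)"
  have K: "0 < K" "K \<le> 3 * exp ?L"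
    using card_dyadic_scales_le[OF assms(4)] unfolding K_def by simp_all
  have le: "2 / \<delta> \<le> D" using assms by (simp add: D_def divide_right_mono)
  have "2 \<le> 2 / \<delta>" using assms by (simp add: field_simps)
  with le have "2 \<le> D" by simp
  have "ln 3 \<le> ln (2 ^ 2 :: real)" by simp
  also have "\<dots> = 2 * ln 2" by (subst ln_realpow) auto
  also have "\<dots> \<le> 2 * ln (D)" using \<open>2 \<le> D\<close> by simp
  finally have ln3: "ln 3 \<le> 2 * ln (D)" .
  have "2 * (K / \<delta>) = 2 / \<delta> * K" by simp
  also have "\<dots> \<le> D * (3 * exp ?L)"
    using K le \<open>2 \<le> D\<close> assms by (intro mult_mono) auto
  finally have "ln (2 * (K / \<delta>)) \<le> ln (D * (3 * exp ?L))"
    using assms K \<open>2 \<le> D\<close> by (subst ln_le_cancel_iff) (auto intro!: mult_pos_pos divide_pos_pos)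
  also have "\<dots> = ln (D) + (ln 3 + ?L)"
    using \<open>2 \<le> D\<close> by (simp add: ln_mult_pos[of D] ln_mult_pos[of 3] del: mult_numeral_left)
  also have "\<dots> \<le> 4 * (ln (D) + ?L)"
  proof -
    have "0 \<le> ln D" "0 \<le> ?L" using \<open>2 \<le> D\<close> by auto
    then show ?thesis using ln3 by (simp only: distrib_left)
  qed
  finally show ?thesis unfolding K_def D_def .
qed

text \<open>
  Whatever the value \<open>V < B\<close>, some scale \<open>b 2^k\<close> with \<open>k < K\<close> is within a factor \<open>2\<close> of
  \<open>max V b\<close>, and \<open>norm_le_of_cosh_le\<close> at that scale gives the bound of the theorem.
\<close>

lemma norm_le_of_cosh_le_at_all_scales:
  fixes N V \<delta> b B :: real and d :: nat
  defines "K \<equiv> nat \<lfloor>log 2 (B / b)\<rfloor> + 1"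
  defines "q \<equiv> ln (2 * (real K / \<delta>))"
  assumes d: "1 \<le> d" and \<delta>: "0 < \<delta>" "\<delta> < 1" and b: "0 < b" "b < B" and N: "0 \<le> N" and V: "V < B"
    and le: "\<And>k. k < K \<Longrightarrow> exp (- (5 * (sqrt (q / (b * 2 ^ k)))\<^sup>2 * V)) * cosh (sqrt (q / (b * 2 ^ k)) * N) \<le> real K / \<delta>"
  shows "N \<le> 22 * sqrt (max V b * (ln (2 * real d / \<delta>) + max 0 (ln (ln (B / b)))))"
proof -
  define U where "U = ln (2 * real d / \<delta>) + max 0 (ln (ln (B / b)))"
  obtain k where k: "k < K" "2 ^ k \<le> max V b / b" "max V b / b < 2 * 2 ^ k"
    unfolding K_def using b V
    by (auto intro: dyadic_scale_exists[of "max V b / b" "B / b"] simp: divide_right_mono)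
  have v: "b * 2 ^ k \<le> max V b" "max V b \<le> 2 * (b * 2 ^ k)"
    using k b by (simp_all add: field_simps)
  have K: "1 \<le> real K" by (simp add: K_def)
  have "1 < 2 * (real K / \<delta>)" using K \<delta> by (simp add: field_simps)
  then have q: "0 < q" by (simp add: q_def)
  have q_le: "q \<le> 4 * U"
    unfolding q_def K_def U_def using d \<delta> b by (intro ln_card_dyadic_scales_le) auto
  have "N \<le> 11 * sqrt (q * (b * 2 ^ k))"
    using b N \<delta> q q_def K v le[OF k(1)] by (intro norm_le_of_cosh_le[where V = V and r = "real K / \<delta>"]) auto
  also have "\<dots> \<le> 11 * sqrt ((4 * U) * max V b)"
    using q_le q v b by (intro mult_left_mono real_sqrt_le_mono mult_mono) auto
  also have "\<dots> = 22 * sqrt (max V b * U)"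
    by (simp add: real_sqrt_mult mult_ac)
  finally show ?thesis unfolding U_def .
qed

section \<open>The norm bound with random variance\<close>

theorem corollary8:
  "\<exists>c::real. \<forall>(M :: 'a measure) (d::nat) (n::nat) (X :: nat \<Rightarrow> 'a \<Rightarrow> nat \<Rightarrow> real)
      (\<sigma> :: nat \<Rightarrow> 'a \<Rightarrow> real) (\<delta>::real) (B::real) (b::real).
     prob_space M \<longrightarrow> 1 \<le> d \<longrightarrow> norm_subGaussian_mds M d n X \<sigma> \<longrightarrow>
     0 < \<delta> \<longrightarrow> 0 < b \<longrightarrow> b < B \<longrightarrow>
     measure M {\<omega> \<in> space M.
        (\<Sum>i=1..n. (\<sigma> i \<omega>)\<^sup>2) \<ge> B \<or>
        L2_set (\<lambda>k. \<Sum>i=1..n. X i \<omega> k) {..<d}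
          \<le> c * sqrt (max (\<Sum>i=1..n. (\<sigma> i \<omega>)\<^sup>2) b *
                 (ln (2 * real d / \<delta>) + max 0 (ln (ln (B / b)))))}
     \<ge> 1 - \<delta>"
proof (intro exI[of _ 22] allI impI)
  fix M :: "'a measure" and d n :: nat and X :: "nat \<Rightarrow> 'a \<Rightarrow> nat \<Rightarrow> real"
    and \<sigma> :: "nat \<Rightarrow> 'a \<Rightarrow> real" and \<delta> B b :: real
  assume M: "prob_space M" and d: "1 \<le> d" and mds: "norm_subGaussian_mds M d n X \<sigma>"
    and \<delta>: "0 < \<delta>" and b: "0 < b" "b < B"
  interpret prob_space M by fact
  define V where "V \<omega> = (\<Sum>i=1..n. (\<sigma> i \<omega>)\<^sup>2)" for \<omega>
  define N where "N \<omega> = L2_set (\<lambda>k. \<Sum>i=1..n. X i \<omega> k) {..<d}" for \<omega>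
  define K where "K = nat \<lfloor>log 2 (B / b)\<rfloor> + 1"
  define q where "q = ln (2 * (real K / \<delta>))"
  define l where "l k = sqrt (q / (b * 2 ^ k))" for k :: nat
  define Z where "Z k \<omega> = exp (- (5 * (l k)\<^sup>2 * V \<omega>)) * cosh (l k * N \<omega>)" for k \<omega>
  define good where "good = {\<omega> \<in> space M. B \<le> V \<omega> \<or>
      N \<omega> \<le> 22 * sqrt (max (V \<omega>) b * (ln (2 * real d / \<delta>) + max 0 (ln (ln (B / b)))))}"
  define bad where "bad k = {\<omega> \<in> space M. real K / \<delta> \<le> Z k \<omega>}" for k
  have XM: "X i \<in> measurable M (borel_vec d)" if "i \<in> {1..n}" for i
    using mds that by (auto simp: norm_subGaussian_mds_def)
  have [measurable]: "\<sigma> i \<in> borel_measurable M" if "i \<in> {1..n}" for i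
  proof (rule measurable_from_subalg)
    show "\<sigma> i \<in> borel_measurable (generated_algebra M d X (i - 1))"
      using mds that by (auto simp: norm_subGaussian_mds_def)
    show "subalgebra M (generated_algebra M d X (i - 1))"
      using XM that by (intro subalgebra_generated_algebra) auto
  qed
  have [measurable]: "(\<lambda>\<omega>. X i \<omega> k) \<in> borel_measurable M" if "i \<in> {1..n}" "k \<in> {..<d}" for i k
    using XM that by (intro measurable_coordinate[of _ _ d]) auto
  have [measurable]: "V \<in> borel_measurable M" "N \<in> borel_measurable M"
    unfolding V_def N_def L2_set_def by measurable
  have [measurable]: "Z k \<in> borel_measurable M" for k
    unfolding Z_def cosh_def by measurable
  have [measurable]: "good \<in> sets M" "bad k \<in> sets M" for k
    unfolding good_def bad_def by measurable
  have K: "1 \<le> real K" by (simp add: K_def)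
  have "1 - \<delta> \<le> prob good"
  proof (cases "\<delta> < 1")
    case False
    then show ?thesis using measure_nonneg[of M good] by linarith
  next
    case True
    have "1 < 2 * (real K / \<delta>)" using K True \<delta> by (simp add: field_simps)
    then have q: "0 < q" by (simp add: q_def)
    have bad_le: "prob (bad k) \<le> \<delta> / real K" for k
    proof -
      have Z: "integrable M (Z k)" "(\<integral>\<omega>. Z k \<omega> \<partial>M) \<le> 1"
        using cosh_supermartingale_expectation_le_1[OF M mds, of "l k" n] q b
        by (simp_all add: Z_def[abs_def] V_def N_def l_def)
      have "prob (bad k) \<le> (\<integral>\<omega>. Z k \<omega> \<partial>M) / (real K / \<delta>)"
        unfolding bad_def
      proof (rule integral_Markov_inequality_measure[OF Z(1), where A = "{}"])
        show "AE \<omega> in M. 0 \<le> Z k \<omega>" by (simp add: Z_def)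
      qed (use K \<delta> in auto)
      also have "\<dots> \<le> 1 / (real K / \<delta>)"
        using Z(2) K \<delta> by (intro divide_right_mono) auto
      finally show ?thesis by simp
    qed
    \<comment> \<open>All scales are controlled at once off an event of probability at most \<open>K (\<delta> / K)\<close>,
      so the scale may be chosen after \<open>V\<close> is seen.\<close>
    have "space M - (\<Union>k<K. bad k) \<subseteq> good"
    proof
      fix \<omega> assume \<omega>: "\<omega> \<in> space M - (\<Union>k<K. bad k)"
      then have "Z k \<omega> \<le> real K / \<delta>" if "k < K" for k
        using that by (auto simp: bad_def not_le less_imp_le)
      then have "N \<omega> \<le> 22 * sqrt (max (V \<omega>) b * (ln (2 * real d / \<delta>) + max 0 (ln (ln (B / b)))))"
        if "V \<omega> < B"
        using d \<delta> True b that
        by (intro norm_le_of_cosh_le_at_all_scales) (auto simp: Z_def l_def q_def K_def N_def)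
      then show "\<omega> \<in> good" using \<omega> by (cases "V \<omega> < B") (auto simp: good_def)
    qed
    then have "prob (space M - (\<Union>k<K. bad k)) \<le> prob good"
      by (intro finite_measure_mono) auto
    moreover have "prob (\<Union>k<K. bad k) \<le> (\<Sum>k<K. prob (bad k))"
      by (intro finite_measure_subadditive_finite) auto
    moreover have "(\<Sum>k<K. prob (bad k)) \<le> (\<Sum>k<K. \<delta> / real K)"
      by (intro sum_mono bad_le)
    moreover have "(\<Sum>k<K. \<delta> / real K) = \<delta>" using K by simp
    ultimately show ?thesis
      by (subst (asm) prob_compl) auto
  qed
  then show "1 - \<delta> \<le> measure M {\<omega> \<in> space M.
      B \<le> (\<Sum>i=1..n. (\<sigma> i \<omega>)\<^sup>2) \<or>
      L2_set (\<lambda>k. \<Sum>i=1..n. X i \<omega> k) {..<d}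
        \<le> 22 * sqrt (max (\<Sum>i=1..n. (\<sigma> i \<omega>)\<^sup>2) b *
               (ln (2 * real d / \<delta>) + max 0 (ln (ln (B / b)))))}"
    unfolding good_def V_def N_def .
qed

end
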